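(* Let $n\ge k\ge 2$, $c\ge 2$, $1\le s\le c-1$, let $t=\lceil sk/c\rceil$, and let $\lambda\in[c]$ satisfy $\lambda\equiv sk\pmod c$. If $n\ge n_0=\left(\binom{k}{t}-m(k,t,\lambda;s+1,c-s+1)\right)t+t-1$, then \[f_{c,s}(n,k)\le\frac{\binom{n}{t}}{\binom{k}{t}-m(k,t,\lambda;s+1,c-s+1)}.\]
   Context: $[m]=\{1,\dots,m\}$; $\binom{X}{k}$ is the family of $k$-subsets of $X$. A hypergraph $\mathcal{F}\subseteq 2^{[n]}$ is $(c,s)$-frameproof if for every $c+1$ edges $A_0,A_1,\dots,A_c\in\mathcal{F}$ with $A_0\neq A_j$ for each $j\in[c]$ ($A_1,\dots,A_c$ not necessarily distinct), there is some $i\in A_0$ with $|\{j\in[c]:i\in A_j\}|<s$. $f_{c,s}(n,k)$ is the maximum size of a $(c,s)$-frameproof $\mathcal{F}\subseteq\binom{[n]}{k}$. A sequence $A_1,\dots,A_\lambda$ of subsets of $[k]$ (repetitions allowed) is $(k_1,k_2)$-disjoint if $\bigcap_{i\in B}A_i=\emptyset$ for every $k_1$-subset $B\subseteq[\lambda]$ and $\bigcup_{i\in B}A_i=[k]$ for every $k_2$-subset $B\subseteq[\lambda]$ (each condition vacuous if the subset size exceeds $\lambda$). $m(k,t,\lambda;k_1,k_2)$ is the maximum size of $\mathcal{F}\subseteq\binom{[k]}{t}$ containing no $A_1,\dots,A_\lambda\in\mathcal{F}$ (not necessarily distinct) forming a $(k_1,k_2)$-disjoint sequence. *)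

theory Defs
  imports Complex_Main "HOL-Library.Ramsey" "HOL-Number_Theory.Cong"
begin

(* nsets X k, written [X]^k, is the library's family of k-element subsets of X. *)

(* The edges A 1, ..., A c may repeat and may be fewer than c distinct ones;
   only A 0 is required to differ from each of the others. *)
definition frameproof :: "nat \<Rightarrow> nat \<Rightarrow> 'a set set \<Rightarrow> bool" where
  "frameproof c s F \<longleftrightarrow>
     (\<forall>A :: nat \<Rightarrow> 'a set.
        (\<forall>j\<in>{0..c}. A j \<in> F) \<and> (\<forall>j\<in>{1..c}. A 0 \<noteq> A j) \<longrightarrow>
        (\<exists>i\<in>A 0. card {j \<in> {1..c}. i \<in> A j} < s))"

definition max_frameproof :: "nat \<Rightarrow> nat \<Rightarrow> nat \<Rightarrow> nat \<Rightarrow> nat" where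
  "max_frameproof c s n k =
     Max {card F | F. F \<subseteq> nsets {1..n} k \<and> frameproof c s F}"

(* Only the values A 1, ..., A l matter.  There are no B of size greater than l,
   so a condition whose subset size exceeds l is vacuous.  The intersection over
   B = {} would be UNIV, but this arises only for k1 = 0. *)
definition disjoint_sequence ::
    "nat \<Rightarrow> nat \<Rightarrow> nat \<Rightarrow> nat \<Rightarrow> (nat \<Rightarrow> nat set) \<Rightarrow> bool" where
  "disjoint_sequence k k1 k2 l A \<longleftrightarrow>
     (\<forall>i\<in>{1..l}. A i \<subseteq> {1..k}) \<and>
     (\<forall>B\<in>nsets {1..l} k1. (\<Inter>i\<in>B. A i) = {}) \<and>
     (\<forall>B\<in>nsets {1..l} k2. (\<Union>i\<in>B. A i) = {1..k})"

(* For l > 0 the empty family is admissible, so the maximum is over a nonempty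
   finite set. *)
definition max_disjoint_free :: "nat \<Rightarrow> nat \<Rightarrow> nat \<Rightarrow> nat \<Rightarrow> nat \<Rightarrow> nat" where
  "max_disjoint_free k t l k1 k2 =
     Max {card F | F. F \<subseteq> nsets {1..k} t \<and>
       \<not> (\<exists>A. (\<forall>i\<in>{1..l}. A i \<in> F) \<and> disjoint_sequence k k1 k2 l A)}"

end

theory Submission imports Defs begin

text \<open>Call a subset of an edge own if no other edge contains it. Write \<open>s k = c (t - 1) + l\<close>
  and \<open>D = (k choose t) - m(k, t, l; s + 1, c - s + 1)\<close>, which is positive. If an edge has no
  own \<open>(t - 1)\<close>-subset, then its \<open>t\<close>-subsets that are not own contain no disjoint sequence,
  since such a sequence could be completed to a violation of frameproofness; so the edge has at
  least \<open>D\<close> own \<open>t\<close>-subsets. To every other edge choose an own \<open>(t - 1)\<close>-subset and give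
  weight \<open>1 / t\<close> to each of its \<open>n - t + 1\<close> supersets of size \<open>t\<close> in the ground set: the bound
  on \<open>n\<close> makes the total at least \<open>D\<close>. No \<open>t\<close>-set receives total weight more than 1.\<close>

section \<open>Distributing points with prescribed multiplicities evenly over \<open>q\<close>
  sets\<close>

lemma inj_on_mod_interval:
  fixes q N r :: nat
  assumes "r \<le> q"
  shows "inj_on (\<lambda>i. i mod q) {N..<N + r}"
proof (rule linorder_inj_onI')
  fix i j assume ij: "i \<in> {N..<N + r}" "j \<in> {N..<N + r}" "i < j"
  show "i mod q \<noteq> j mod q"
  proof
    assume "i mod q = j mod q"
    then have "q dvd j - i"
      using ij(3) by (metis less_or_eq_imp_le mod_eq_dvd_iff_nat)
    moreover have "0 < j - i" "j - i < q"
      using ij assms by auto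
    ultimately show False
      using nat_dvd_not_less by blast
  qed
qed

text \<open>This gives the sizes in the distribution below. With \<open>q = c\<close> the first
  \<open>l\<close> sets get size \<open>p + 1\<close>; with \<open>l = 0\<close> all
  \<open>q\<close> sets get size exactly \<open>p\<close>.\<close>

lemma card_residue_class:
  fixes q p l j :: nat
  assumes "l \<le> q" "j < q"
  shows "card {i. i < q * p + l \<and> i mod q = j} = (if j < l then p + 1 else p)"
proof -
  have "{i. i < q * p + l \<and> i mod q = j} = (\<lambda>a. q * a + j) ` {a. q * a + j < q * p + l}"
    using assms by (auto simp: image_iff) (metis mult_div_mod_eq)
  moreover have "inj_on (\<lambda>a. q * a + j) {a. q * a + j < q * p + l}"
    using assms by (auto simp: inj_on_def)
  moreover have "{a. q * a + j < q * p + l} = {..<(if j < l then p + 1 else p)}"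
  proof -
    have "q * a + j < q * p + l \<longleftrightarrow> a < (if j < l then p + 1 else p)" for a
    proof (cases "a < p")
      case True
      then have "q * (a + 1) \<le> q * p"
        by (intro mult_le_mono2) auto
      then show ?thesis
        using True assms by (auto simp: algebra_simps)
    next
      case False
      show ?thesis
      proof (cases "a = p")
        case False
        with \<open>\<not> a < p\<close> have "q * (p + 1) \<le> q * a"
          by (intro mult_le_mono2) auto
        then show ?thesis
          using \<open>\<not> a < p\<close> False assms by (auto simp: algebra_simps)
      qed auto
    qed
    then show ?thesis by auto
  qed
  ultimately show ?thesis
    by (simp add: card_image)
qed

text \<open>Write each \<open>x\<close> down \<open>r x\<close> times in a row, all of it in one list, and put the
  \<open>i\<close>-th entry into the set with index \<open>i mod q\<close>: since \<open>r x \<le> q\<close>, the copies of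
  \<open>x\<close> go to distinct sets.\<close>

lemma sets_with_degrees:
  fixes r :: "'a \<Rightarrow> nat"
  assumes "finite X" "\<forall>x\<in>X. r x \<le> q"
  obtains B where "\<And>j. B j \<subseteq> X"
    "\<And>j. card (B j) = card {i. i < sum r X \<and> i mod q = j}"
    "\<And>x. x \<in> X \<Longrightarrow> card {j. j < q \<and> x \<in> B j} = r x"
  using assms
proof (induction X arbitrary: thesis rule: finite_induct)
  case empty
  show ?case by (rule empty.prems(1)[of "\<lambda>_. {}"]) auto
next
  case (insert x X)
  have "\<forall>x\<in>X. r x \<le> q" using insert.prems(2) by simp
  then obtain B where sub: "\<And>j. B j \<subseteq> X"
    and size: "\<And>j. card (B j) = card {i. i < sum r X \<and> i mod q = j}"
    and deg: "\<And>y. y \<in> X \<Longrightarrow> card {j. j < q \<and> y \<in> B j} = r y"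
    using insert.IH by blast
  \<comment> \<open>\<open>N\<close> is the length of the list written for \<open>X\<close>, so the
    copies of \<open>x\<close> take the positions from \<open>N\<close> on; \<open>M\<close> is the
    set of indices of the sets that receive \<open>x\<close>.\<close>
  define N where "N = sum r X"
  define M where "M = (\<lambda>i. i mod q) ` {N..<N + r x}"
  define B' where "B' j = (if j \<in> M then insert x (B j) else B j)" for j
  have rq: "r x \<le> q" using insert.prems by simp
  note inj = inj_on_mod_interval[OF rq, of N]
  have cardM: "card M = r x"
    unfolding M_def using inj by (simp add: card_image)
  \<comment> \<open>For \<open>q = 0\<close> the map \<open>i mod q\<close> is the identity, but
    then \<open>r x = 0\<close> and \<open>M\<close> is empty.\<close>
  have Mq: "M \<subseteq> {..<q}"
  proof (cases "q = 0")
    case True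
    then show ?thesis using rq by (simp add: M_def)
  qed (auto simp: M_def)
  \<comment> \<open>Injectivity lets the new block meet each residue at most once, so the
    \<open>j\<close>-th count grows by one exactly when \<open>x\<close> joins
    \<open>B j\<close>.\<close>
  have new: "card {i \<in> {N..<N + r x}. i mod q = j} = (if j \<in> M then 1 else 0)" for j
  proof (cases "j \<in> M")
    case True
    then obtain i where i: "i \<in> {N..<N + r x}" "j = i mod q" by (auto simp: M_def)
    then have "{i \<in> {N..<N + r x}. i mod q = j} = {i}"
      using inj by (auto simp: inj_on_def)
    then show ?thesis using True by simp
  next
    case False
    then have "{i \<in> {N..<N + r x}. i mod q = j} = {}" by (auto simp: M_def)
    then show ?thesis using False by simp
  qed
  have xB: "x \<notin> B j" "finite (B j)" for j
    using sub insert.hyps finite_subset by blast+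
  have "card (B' j) = card {i. i < sum r (insert x X) \<and> i mod q = j}" for j
  proof -
    have "sum r (insert x X) = N + r x"
      using insert.hyps by (simp add: N_def)
    then have "{i. i < sum r (insert x X) \<and> i mod q = j}
        = {i. i < N \<and> i mod q = j} \<union> {i \<in> {N..<N + r x}. i mod q = j}"
      by auto
    then have "card {i. i < sum r (insert x X) \<and> i mod q = j}
        = card {i. i < N \<and> i mod q = j} + card {i \<in> {N..<N + r x}. i mod q = j}"
      by (simp add: card_Un_disjoint disjoint_iff)
    also have "\<dots> = card (B' j)"
      unfolding new using xB size[of j] by (simp add: B'_def N_def)
    finally show ?thesis by simp
  qed
  moreover have "B' j \<subseteq> insert x X" for j
    using sub by (auto simp: B'_def)
  moreover have "card {j. j < q \<and> y \<in> B' j} = r y" if "y \<in> insert x X" for y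
  proof (cases "y = x")
    case True
    then have "{j. j < q \<and> y \<in> B' j} = M"
      using Mq xB by (auto simp: B'_def)
    then show ?thesis using True cardM by simp
  next
    case False
    then have "{j. j < q \<and> y \<in> B' j} = {j. j < q \<and> y \<in> B j}"
      by (auto simp: B'_def)
    then show ?thesis using False that deg by simp
  qed
  ultimately show ?case using insert.prems(1)[of B'] by blast
qed

section \<open>Disjoint sequences as degree conditions, and the two extremal numbers\<close>

text \<open>Some \<open>a + 1\<close> of the sets share the point \<open>x\<close> exactly when more
  than \<open>a\<close> of them contain it; dually, some \<open>b + 1\<close> of them all miss
  \<open>x\<close> exactly when more than \<open>b\<close> do. The degree form is what the
  constructions below produce and consume.\<close>

lemma disjoint_sequence_iff:
  "disjoint_sequence k (a + 1) (b + 1) l A \<longleftrightarrow>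
     (\<forall>i\<in>{1..l}. A i \<subseteq> {1..k}) \<and>
     (\<forall>x\<in>{1..k}. card {i\<in>{1..l}. x \<in> A i} \<le> a \<and> card {i\<in>{1..l}. x \<notin> A i} \<le> b)"
  (is "?L \<longleftrightarrow> ?R")
proof
  assume L: ?L
  have "card {i\<in>{1..l}. x \<in> A i} \<le> a" if "x \<in> {1..k}" for x
  proof (rule ccontr)
    assume "\<not> ?thesis"
    then obtain B where "B \<subseteq> {i\<in>{1..l}. x \<in> A i}" "card B = a + 1" "finite B"
      by (metis (lifting) obtain_subset_with_card_n not_le Suc_eq_plus1 Suc_leI)
    then have "B \<in> nsets {1..l} (a + 1)" "x \<in> (\<Inter>i\<in>B. A i)"
      by (auto simp: nsets_def)
    then show False using L by (force simp: disjoint_sequence_def)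
  qed
  moreover have "card {i\<in>{1..l}. x \<notin> A i} \<le> b" if "x \<in> {1..k}" for x
  proof (rule ccontr)
    assume "\<not> ?thesis"
    then obtain B where "B \<subseteq> {i\<in>{1..l}. x \<notin> A i}" "card B = b + 1" "finite B"
      by (metis (lifting) obtain_subset_with_card_n not_le Suc_eq_plus1 Suc_leI)
    then have "B \<in> nsets {1..l} (b + 1)" "x \<notin> (\<Union>i\<in>B. A i)"
      by (auto simp: nsets_def)
    moreover have "(\<Union>i\<in>B. A i) = {1..k}"
      using L calculation(1) unfolding disjoint_sequence_def by blast
    ultimately show False using that by blast
  qed
  ultimately show ?R using L by (auto simp: disjoint_sequence_def)
next
  assume R: ?R
  have "(\<Inter>i\<in>B. A i) = {}" if "B \<in> nsets {1..l} (a + 1)" for B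
  proof (rule ccontr)
    assume "(\<Inter>i\<in>B. A i) \<noteq> {}"
    then obtain x where x: "\<And>i. i \<in> B \<Longrightarrow> x \<in> A i" by auto
    have B: "B \<subseteq> {1..l}" "card B = a + 1" using that by (auto simp: nsets_def)
    \<comment> \<open>\<open>B\<close> is nonempty because of the \<open>+ 1\<close>; only then does
      a common point have to lie in \<open>{1..k}\<close>.\<close>
    then obtain i where "i \<in> B" by fastforce
    then have "x \<in> {1..k}" using x R B by blast
    moreover have "card B \<le> card {i\<in>{1..l}. x \<in> A i}"
      using x B by (intro card_mono) auto
    ultimately show False using R B by fastforce
  qed
  moreover have "(\<Union>i\<in>B. A i) = {1..k}" if "B \<in> nsets {1..l} (b + 1)" for B
  proof -
    have B: "B \<subseteq> {1..l}" "card B = b + 1" using that by (auto simp: nsets_def)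
    have "x \<in> (\<Union>i\<in>B. A i)" if "x \<in> {1..k}" for x
    proof (rule ccontr)
      assume "x \<notin> (\<Union>i\<in>B. A i)"
      then have "card B \<le> card {i\<in>{1..l}. x \<notin> A i}"
        using B by (intro card_mono) auto
      then show False using R B that by fastforce
    qed
    then show ?thesis using R B by blast
  qed
  ultimately show ?L using R by (simp add: disjoint_sequence_def)
qed

lemma max_disjoint_free_attained:
  assumes "l \<ge> 1"
  obtains F where "F \<subseteq> nsets {1..k} t"
    "\<not> (\<exists>A. (\<forall>i\<in>{1..l}. A i \<in> F) \<and> disjoint_sequence k k1 k2 l A)"
    "card F = max_disjoint_free k t l k1 k2"
proof -
  let ?M = "{card F | F. F \<subseteq> nsets {1..k} t \<and>
       \<not> (\<exists>A. (\<forall>i\<in>{1..l}. A i \<in> F) \<and> disjoint_sequence k k1 k2 l A)}"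
  have "?M \<subseteq> card ` Pow (nsets {1..k} t)" by auto
  then have "finite ?M"
    by (rule finite_subset) (simp add: finite_imp_finite_nsets)
  moreover have "?M \<noteq> {}"
    using assms by (auto intro!: exI[of _ "{}"])
  ultimately have "Max ?M \<in> ?M" by (rule Max_in)
  then show ?thesis
    using that unfolding max_disjoint_free_def by auto
qed

lemma card_le_max_disjoint_free:
  assumes "F \<subseteq> nsets {1..k} t"
    "\<not> (\<exists>A. (\<forall>i\<in>{1..l}. A i \<in> F) \<and> disjoint_sequence k k1 k2 l A)"
  shows "card F \<le> max_disjoint_free k t l k1 k2"
proof -
  let ?M = "{card F | F. F \<subseteq> nsets {1..k} t \<and>
       \<not> (\<exists>A. (\<forall>i\<in>{1..l}. A i \<in> F) \<and> disjoint_sequence k k1 k2 l A)}"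
  have "?M \<subseteq> card ` Pow (nsets {1..k} t)" by auto
  then have "finite ?M"
    by (rule finite_subset) (simp add: finite_imp_finite_nsets)
  then show ?thesis
    unfolding max_disjoint_free_def using assms by (intro Max_ge) auto
qed

lemma max_frameproof_attained:
  obtains F where "F \<subseteq> nsets {1..n} k" "frameproof c s F" "card F = max_frameproof c s n k"
proof -
  let ?M = "{card F | F. F \<subseteq> nsets {1..n} k \<and> frameproof c s F}"
  have "?M \<subseteq> card ` Pow (nsets {1..n} k)" by auto
  then have "finite ?M"
    by (rule finite_subset) (simp add: finite_imp_finite_nsets)
  moreover have "frameproof c s {}" by (auto simp: frameproof_def)
  then have "?M \<noteq> {}" by auto
  ultimately have "Max ?M \<in> ?M" by (rule Max_in)
  then show ?thesis
    using that unfolding max_frameproof_def by auto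
qed

text \<open>This makes the denominator positive: the family of all \<open>(p + 1)\<close>-subsets
  does contain a disjoint sequence. Spread \<open>s\<close> copies of each point,
  \<open>c * p + l\<close> in all, evenly over \<open>c\<close> sets; the first \<open>l\<close> of
  them have size \<open>p + 1\<close>, each point lies in at most \<open>s\<close> of these and is
  missed by at most \<open>c - s\<close>.\<close>

lemma max_disjoint_free_less:
  fixes s k c p l :: nat
  assumes sk: "s * k = c * p + l" and l: "1 \<le> l" "l \<le> c" and s: "s \<le> c"
  shows "max_disjoint_free k (p + 1) l (s + 1) (c - s + 1) < k choose (p + 1)"
proof -
  obtain B where sub: "\<And>j. B j \<subseteq> {1..k}"
    and size: "\<And>j. card (B j) = card {i. i < (\<Sum>x\<in>{1..k}. s) \<and> i mod c = j}"
    and deg: "\<And>x. x \<in> {1..k} \<Longrightarrow> card {j. j < c \<and> x \<in> B j} = s"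
    using sets_with_degrees[of "{1..k}" "\<lambda>_. s" c] s finite_atLeastAtMost by blast
  define A where "A i = B (i - 1)" for i
  \<comment> \<open>Keeping only \<open>l\<close> of the \<open>c\<close> sets, now numbered from 1,
    cannot raise any count.\<close>
  have card_shift: "card {i \<in> {1..l}. P (i - 1)} \<le> card {j. j < c \<and> P j}" for P :: "nat \<Rightarrow> bool"
  proof (rule card_inj_on_le[of "\<lambda>i. i - 1"])
    show "inj_on (\<lambda>i. i - 1) {i \<in> {1..l}. P (i - 1)}"
      by (auto simp: inj_on_def)
  qed (use l in auto)
  have "disjoint_sequence k (s + 1) (c - s + 1) l A"
    unfolding disjoint_sequence_iff
  proof (intro conjI ballI)
    fix x assume x: "x \<in> {1..k}"
    show "card {i \<in> {1..l}. x \<in> A i} \<le> s"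
      using card_shift[of "\<lambda>j. x \<in> B j"] deg[OF x] by (simp add: A_def)
    have "card {j. j < c \<and> x \<notin> B j} = card ({..<c} - {j. j < c \<and> x \<in> B j})"
      by (rule arg_cong[of _ _ card]) auto
    also have "\<dots> = c - s"
      using deg[OF x] by (subst card_Diff_subset) auto
    finally show "card {i \<in> {1..l}. x \<notin> A i} \<le> c - s"
      using card_shift[of "\<lambda>j. x \<notin> B j"] by (simp add: A_def)
  qed (use sub in \<open>auto simp: A_def\<close>)
  moreover have "A i \<in> nsets {1..k} (p + 1)" if "i \<in> {1..l}" for i
  proof -
    have "card (A i) = p + 1"
    proof -
      have "i - 1 < l" "i - 1 < c" using that l by auto
      then show ?thesis
        using l card_residue_class[of l c "i - 1" p] sk size[of "i - 1"]
        by (simp add: A_def mult.commute)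
    qed
    moreover have "A i \<subseteq> {1..k}" using sub by (simp add: A_def)
    ultimately show ?thesis
      using finite_subset by (auto simp: nsets_def)
  qed
  moreover obtain F where F: "F \<subseteq> nsets {1..k} (p + 1)"
    "\<not> (\<exists>A. (\<forall>i\<in>{1..l}. A i \<in> F) \<and> disjoint_sequence k (s + 1) (c - s + 1) l A)"
    "card F = max_disjoint_free k (p + 1) l (s + 1) (c - s + 1)"
    using max_disjoint_free_attained[OF l(1)] by metis
  \<comment> \<open>\<open>F\<close> cannot contain every member of the sequence \<open>A\<close>,
    whose members are all \<open>(p + 1)\<close>-subsets.\<close>
  ultimately have "F \<subset> nsets {1..k} (p + 1)"
    by blast
  then have "card F < card (nsets {1..k} (p + 1))"
    by (intro psubset_card_mono) (simp add: finite_imp_finite_nsets)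
  then show ?thesis
    using F(3) by (simp add: card_nsets)
qed

section \<open>Own subsets of a single edge\<close>

definition own :: "'a set set \<Rightarrow> 'a set \<Rightarrow> 'a set \<Rightarrow> bool" where
  "own F A T \<longleftrightarrow> T \<subseteq> A \<and> (\<forall>B\<in>F. T \<subseteq> B \<longrightarrow> B = A)"

lemma own_unique: "own F A T \<Longrightarrow> T \<subseteq> B \<Longrightarrow> B \<in> F \<Longrightarrow> B = A"
  by (simp add: own_def)

text \<open>The sequence is completed by \<open>c - l\<close> sets of size \<open>p\<close> so that every point of the edge
  is covered exactly \<open>s\<close> times; replacing each set by another edge containing it
  contradicts frameproofness.\<close>

lemma no_disjoint_sequence_of_nonown:
  fixes T :: "nat \<Rightarrow> 'a set"
  assumes fp: "frameproof c s F" and A: "A \<in> F" "finite A" "card A = k"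
    and sk: "s * k = c * p + l" and l: "1 \<le> l" "l \<le> c" and s: "s \<le> c"
    and noown: "\<And>S. S \<subseteq> A \<Longrightarrow> card S = p \<Longrightarrow> \<not> own F A S"
    and T: "\<And>i. i \<in> {1..l} \<Longrightarrow> T i \<subseteq> A \<and> card (T i) = p + 1 \<and> \<not> own F A (T i)"
    and le: "\<And>x. x \<in> A \<Longrightarrow> card {i\<in>{1..l}. x \<in> T i} \<le> s"
    and ge: "\<And>x. x \<in> A \<Longrightarrow> card {i\<in>{1..l}. x \<notin> T i} \<le> c - s"
  shows False
proof -
  define d where "d x = card {i\<in>{1..l}. x \<in> T i}" for x
  define q where "q = c - l"
  have d_compl: "d x + card {i\<in>{1..l}. x \<notin> T i} = l" for x
  proof -
    have "card ({i\<in>{1..l}. x \<in> T i} \<union> {i\<in>{1..l}. x \<notin> T i}) = d x + card {i\<in>{1..l}. x \<notin> T i}"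
      unfolding d_def by (intro card_Un_disjoint) auto
    moreover have "{i\<in>{1..l}. x \<in> T i} \<union> {i\<in>{1..l}. x \<notin> T i} = {1..l}" by auto
    ultimately show ?thesis by simp
  qed
  \<comment> \<open>The point \<open>x\<close> still needs \<open>s - d x\<close> of the
    \<open>q\<close> new sets. It is missed by \<open>l - d x \<le> c - s\<close> of the given ones,
    which rearranges to \<open>s - d x \<le> c - l\<close>.\<close>
  have r_le: "\<forall>x\<in>A. s - d x \<le> q"
  proof
    fix x assume "x \<in> A"
    then show "s - d x \<le> q"
      using ge[of x] d_compl[of x] s l unfolding q_def by linarith
  qed
  have "(\<Sum>x\<in>A. d x) = (\<Sum>i\<in>{1..l}. card {x\<in>A. x \<in> T i})"
    unfolding d_def using A(2) by (intro sum_multicount_gen) auto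
  also have "\<dots> = (\<Sum>i\<in>{1..l}. p + 1)"
  proof (rule sum.cong)
    fix i assume "i \<in> {1..l}"
    then have "{x\<in>A. x \<in> T i} = T i" "card (T i) = p + 1" using T by auto
    then show "card {x\<in>A. x \<in> T i} = p + 1" by simp
  qed simp
  finally have sum_d: "(\<Sum>x\<in>A. d x) = l * (p + 1)" by simp
  have "(\<Sum>x\<in>A. s - d x) + (\<Sum>x\<in>A. d x) = (\<Sum>x\<in>A. s)"
    unfolding sum.distrib[symmetric] using le by (intro sum.cong) (auto simp: d_def)
  then have "(\<Sum>x\<in>A. s - d x) + l * (p + 1) = c * p + l"
    using sum_d sk A(3) by (simp add: mult.commute)
  moreover have "c * p = q * p + l * p"
    using l by (simp add: q_def flip: add_mult_distrib)
  \<comment> \<open>The missing incidences number \<open>c * p + l - l * (p + 1) = q * p\<close>, so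
    an even distribution gives each new set exactly \<open>p\<close> points.\<close>
  ultimately have sum_r: "(\<Sum>x\<in>A. s - d x) = q * p"
    by (simp add: algebra_simps)
  obtain B where sub: "\<And>j. B j \<subseteq> A"
    and size: "\<And>j. card (B j) = card {i. i < q * p \<and> i mod q = j}"
    and deg: "\<And>x. x \<in> A \<Longrightarrow> card {j. j < q \<and> x \<in> B j} = s - d x"
    using sets_with_degrees[OF A(2) r_le] unfolding sum_r by blast
  \<comment> \<open>The given sets keep the indices 1 to \<open>l\<close>; the new ones, numbered
    from 0, move to \<open>l + 1\<close> up to \<open>c\<close>.\<close>
  define C where "C j = (if j \<le> l then T j else B (j - l - 1))" for j
  have "\<exists>E\<in>F. E \<noteq> A \<and> C j \<subseteq> E" if "j \<in> {1..c}" for j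
  proof -
    have "C j \<subseteq> A \<and> \<not> own F A (C j)"
    proof (cases "j \<le> l")
      case True
      then show ?thesis using T[of j] that by (simp add: C_def)
    next
      case False
      then have "j - l - 1 < q" using that by (auto simp: q_def)
      then have "card (B (j - l - 1)) = p"
        using size[of "j - l - 1"] card_residue_class[of 0 q "j - l - 1" p] by simp
      then show ?thesis using False sub noown by (simp add: C_def)
    qed
    then show ?thesis by (auto simp: own_def)
  qed
  then have "\<forall>j\<in>{1..c}. \<exists>E. E \<in> F \<and> E \<noteq> A \<and> C j \<subseteq> E" by blast
  from bchoice[OF this] obtain E
    where E: "\<And>j. j \<in> {1..c} \<Longrightarrow> E j \<in> F \<and> E j \<noteq> A \<and> C j \<subseteq> E j"
    by blast
  define E' where "E' j = (if j = 0 then A else E j)" for j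
  have "\<forall>j\<in>{0..c}. E' j \<in> F" "\<forall>j\<in>{1..c}. E' 0 \<noteq> E' j"
    using E A(1) by (fastforce simp: E'_def)+
  then have "\<exists>x\<in>E' 0. card {j \<in> {1..c}. x \<in> E' j} < s"
    using fp unfolding frameproof_def by blast
  then obtain x where x: "x \<in> A" and few: "card {j \<in> {1..c}. x \<in> E' j} < s"
    by (auto simp: E'_def)
  \<comment> \<open>\<open>?U\<close> and \<open>?V\<close> are the indices \<open>j\<close> for
    which \<open>C j\<close> contains \<open>x\<close>. There are \<open>s\<close> of them, and
    passing to the larger edges loses none.\<close>
  let ?U = "{i\<in>{1..l}. x \<in> T i}"
  let ?V = "(\<lambda>j. j + l + 1) ` {j. j < q \<and> x \<in> B j}"
  have "card (?U \<union> ?V) = card ?U + card ?V"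
    by (intro card_Un_disjoint) auto
  also have "card ?V = s - d x"
    using deg[OF x] by (subst card_image) (auto simp: inj_on_def)
  also have "card ?U + (s - d x) = s"
    using le[OF x] by (simp add: d_def)
  finally have "card (?U \<union> ?V) = s" .
  moreover have "?U \<union> ?V \<subseteq> {j \<in> {1..c}. x \<in> E' j}"
  proof
    fix j assume j: "j \<in> ?U \<union> ?V"
    then have jc: "j \<in> {1..c}" using l by (auto simp: q_def)
    moreover have "x \<in> C j" using j by (auto simp: C_def)
    ultimately show "j \<in> {j \<in> {1..c}. x \<in> E' j}"
      using E[OF jc] by (auto simp: E'_def)
  qed
  then have "card (?U \<union> ?V) \<le> card {j \<in> {1..c}. x \<in> E' j}"
    by (intro card_mono) auto
  ultimately show False using few by simp
qed

text \<open>The \<open>(p + 1)\<close>-subsets that are not own, carried to \<open>{1..k}\<close> by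
  a bijection, form a family without disjoint sequences. The extremal number bounds how many there
  are, and all other \<open>(p + 1)\<close>-subsets are own.\<close>

lemma card_own_ge:
  fixes A :: "'a set"
  assumes fp: "frameproof c s F" and A: "A \<in> F" "finite A" "card A = k"
    and sk: "s * k = c * p + l" and l: "1 \<le> l" "l \<le> c" and s: "s \<le> c"
    and noown: "\<And>S. S \<subseteq> A \<Longrightarrow> card S = p \<Longrightarrow> \<not> own F A S"
  shows "(k choose (p + 1)) - max_disjoint_free k (p + 1) l (s + 1) (c - s + 1)
           \<le> card {T \<in> nsets A (p + 1). own F A T}"
proof -
  obtain h where h: "bij_betw h A {1..k}"
    using A by (metis ex_bij_betw_finite_nat bij_betw_trans card_atLeastAtMost
        diff_Suc_1 finite_atLeastAtMost finite_same_card_bij)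
  then have inj: "inj_on h A" and img: "h ` A = {1..k}"
    by (auto simp: bij_betw_def)
  define N where "N = {T \<in> nsets A (p + 1). \<not> own F A T}"
  have N: "T \<subseteq> A" "card T = p + 1" "\<not> own F A T" if "T \<in> N" for T
    using that by (auto simp: N_def nsets_def)
  have injN: "inj_on ((`) h) N"
    using N(1) by (intro inj_onI) (metis inj inj_on_image_eq_iff)
  have "(`) h ` N \<subseteq> nsets {1..k} (p + 1)"
  proof (rule image_subsetI)
    fix T assume T: "T \<in> N"
    have "card (h ` T) = p + 1"
      using N[OF T] inj by (metis card_image inj_on_subset)
    moreover have "h ` T \<subseteq> {1..k}" using N(1)[OF T] img by blast
    moreover have "finite T" using N(1)[OF T] A(2) finite_subset by blast
    ultimately show "h ` T \<in> nsets {1..k} (p + 1)" by (simp add: nsets_def)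
  qed
  moreover have "\<not> (\<exists>G. (\<forall>i\<in>{1..l}. G i \<in> (`) h ` N) \<and>
      disjoint_sequence k (s + 1) (c - s + 1) l G)"
  proof
    assume "\<exists>G. (\<forall>i\<in>{1..l}. G i \<in> (`) h ` N) \<and> disjoint_sequence k (s + 1) (c - s + 1) l G"
    then obtain G where mem: "\<forall>i\<in>{1..l}. G i \<in> (`) h ` N"
      and G: "disjoint_sequence k (s + 1) (c - s + 1) l G"
      by (elim exE conjE)
    then have "\<forall>i\<in>{1..l}. \<exists>T. T \<in> N \<and> G i = h ` T" by fast
    from bchoice[OF this] obtain T
      where T: "\<And>i. i \<in> {1..l} \<Longrightarrow> T i \<in> N \<and> G i = h ` T i"
      by blast
    \<comment> \<open>Injectivity of \<open>h\<close> makes the degrees in \<open>G\<close> and in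
      its preimage \<open>T\<close> agree.\<close>
    have hx: "h x \<in> G i \<longleftrightarrow> x \<in> T i" if "i \<in> {1..l}" "x \<in> A" for i x
      using T[OF that(1)] that(2) N(1)[of "T i"] inj by (simp add: inj_on_image_mem_iff)
    have deg: "card {i\<in>{1..l}. x \<in> T i} \<le> s" "card {i\<in>{1..l}. x \<notin> T i} \<le> c - s"
      if x: "x \<in> A" for x
    proof -
      have "{i\<in>{1..l}. x \<in> T i} = {i\<in>{1..l}. h x \<in> G i}"
        "{i\<in>{1..l}. x \<notin> T i} = {i\<in>{1..l}. h x \<notin> G i}"
        using hx x by blast+
      moreover have "h x \<in> {1..k}" using x img by blast
      ultimately show "card {i\<in>{1..l}. x \<in> T i} \<le> s" "card {i\<in>{1..l}. x \<notin> T i} \<le> c - s"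
        using G unfolding disjoint_sequence_iff by simp_all
    qed
    show False
      using no_disjoint_sequence_of_nonown[OF fp A sk l s noown, of T] T N deg by blast
  qed
  ultimately have "card ((`) h ` N) \<le> max_disjoint_free k (p + 1) l (s + 1) (c - s + 1)"
    by (rule card_le_max_disjoint_free)
  then have le: "card N \<le> max_disjoint_free k (p + 1) l (s + 1) (c - s + 1)"
    using injN by (simp add: card_image)
  have fin: "finite (nsets A (p + 1))"
    using A(2) by (simp add: finite_imp_finite_nsets)
  have "{T \<in> nsets A (p + 1). own F A T} \<union> N = nsets A (p + 1)"
    by (auto simp: N_def)
  moreover have "card ({T \<in> nsets A (p + 1). own F A T} \<union> N)
      = card {T \<in> nsets A (p + 1). own F A T} + card N"
    using fin by (intro card_Un_disjoint) (auto simp: N_def)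
  moreover have "card (nsets A (p + 1)) = k choose (p + 1)"
    using A by (simp add: card_nsets)
  ultimately have "card {T \<in> nsets A (p + 1). own F A T} + card N = k choose (p + 1)"
    by metis
  then show ?thesis using le by linarith
qed

section \<open>Double counting over the whole family\<close>

lemma card_nsets_supersets:
  assumes "finite X" "S \<subseteq> X" "card S = p"
  shows "card {T \<in> nsets X (p + 1). S \<subseteq> T} = card X - p"
proof -
  have fS: "finite S" using assms finite_subset by blast
  have "{T \<in> nsets X (p + 1). S \<subseteq> T} = (\<lambda>x. insert x S) ` (X - S)"
  proof (intro equalityI subsetI)
    fix T assume "T \<in> {T \<in> nsets X (p + 1). S \<subseteq> T}"
    then have T: "T \<subseteq> X" "finite T" "card T = p + 1" "S \<subseteq> T" by (auto simp: nsets_def)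
    then have "card (T - S) = 1" using assms fS by (simp add: card_Diff_subset)
    then obtain x where "T - S = {x}" by (auto simp: card_1_singleton_iff)
    then have "T = insert x S" "x \<in> X - S" using T by auto
    then show "T \<in> (\<lambda>x. insert x S) ` (X - S)" by blast
  qed (use assms fS in \<open>auto simp: nsets_def\<close>)
  moreover have "inj_on (\<lambda>x. insert x S) (X - S)"
    by (auto simp: inj_on_def)
  ultimately show ?thesis
    using assms fS by (simp add: card_image card_Diff_subset)
qed

text \<open>The weights appear here with denominators cleared. Edges in \<open>F1\<close> are
  charged to their own sets in \<open>P\<close>, edges in \<open>F0\<close> to the supersets in
  \<open>Q\<close> of their chosen \<open>p\<close>-sets. Since \<open>P\<close> and
  \<open>Q\<close> are disjoint, it suffices that \<open>D * card F1 \<le> card P\<close> and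
  \<open>D * card F0 \<le> card Q\<close>.\<close>

lemma own_counting:
  fixes X :: "'a set" and D p :: nat
  assumes X: "finite X" and F: "\<And>A. A \<in> F \<Longrightarrow> A \<subseteq> X"
    and big: "D * (p + 1) + p \<le> card X"
    and own: "\<And>A. A \<in> F \<Longrightarrow> (\<exists>S. card S = p \<and> own F A S) \<or>
                               D \<le> card {T \<in> nsets A (p + 1). own F A T}"
  shows "D * card F \<le> card X choose (p + 1)"
proof -
  have finF: "finite F" using X F by (metis finite_Pow_iff finite_subset Pow_iff subsetI)
  define F0 where "F0 = {A \<in> F. \<exists>S. card S = p \<and> own F A S}"
  define F1 where "F1 = F - F0"
  have fin01: "finite F0" "finite F1" using finF by (simp_all add: F0_def F1_def)
  have cardF: "card F = card F0 + card F1"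
    using finF by (auto simp: F0_def F1_def card_Diff_subset card_mono)
  have "\<forall>A\<in>F0. \<exists>S. card S = p \<and> own F A S" by (simp add: F0_def)
  from bchoice[OF this] obtain S
    where S: "\<And>A. A \<in> F0 \<Longrightarrow> card (S A) = p \<and> own F A (S A)"
    by blast
  have S_sub: "S A \<subseteq> X" if "A \<in> F0" for A
    using S[OF that] F[of A] that by (auto simp: own_def F0_def)
  define Q where "Q = {T \<in> nsets X (p + 1). \<exists>A\<in>F0. S A \<subseteq> T}"
  define P where "P = (\<Union>A\<in>F1. {T \<in> nsets A (p + 1). own F A T})"
  have finX: "finite (nsets X (p + 1))" using X by (simp add: finite_imp_finite_nsets)
  have finQ: "finite Q" using finX by (simp add: Q_def)
  have P_sub: "P \<subseteq> nsets X (p + 1)"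
    using F by (fastforce simp: P_def F1_def nsets_def)
  \<comment> \<open>If \<open>T\<close> is own for \<open>A\<close> and contains \<open>S B\<close>,
    then \<open>A\<close> contains \<open>S B\<close>, which is own for \<open>B\<close>; hence
    \<open>A = B\<close>, although \<open>F0\<close> and \<open>F1\<close> are disjoint.\<close>
  have "P \<inter> Q = {}"
  proof (rule ccontr)
    assume "P \<inter> Q \<noteq> {}"
    then obtain T A B where "A \<in> F1" "own F A T" "B \<in> F0" "S B \<subseteq> T"
      by (auto simp: P_def Q_def)
    moreover from this have "A = B"
      using S[of B] by (intro own_unique[of F B "S B"]) (auto simp: own_def F1_def)
    ultimately show False by (simp add: F1_def)
  qed
  then have PQ: "card P + card Q \<le> card X choose (p + 1)"
    using P_sub finX finQ card_mono[OF finX, of "P \<union> Q"]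
    by (simp add: card_Un_disjoint finite_subset card_nsets Q_def)
  have "D * card F1 \<le> (\<Sum>A\<in>F1. card {T \<in> nsets A (p + 1). own F A T})"
    using own by (subst mult.commute, intro sum_bounded_below[of F1 D, simplified])
      (auto simp: F1_def F0_def)
  also have "\<dots> = card P"
    unfolding P_def
  proof (rule card_UN_disjoint[symmetric])
    show "\<forall>A\<in>F1. finite {T \<in> nsets A (p + 1). own F A T}"
      using X F finite_subset by (fastforce simp: F1_def finite_imp_finite_nsets)
    show "\<forall>A\<in>F1. \<forall>B\<in>F1. A \<noteq> B \<longrightarrow>
        {T \<in> nsets A (p + 1). own F A T} \<inter> {T \<in> nsets B (p + 1). own F B T} = {}"
      by (auto simp: own_def F1_def)
  qed (rule fin01)
  finally have 1: "D * card F1 \<le> card P" .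
  \<comment> \<open>Count the pairs of an edge \<open>A\<close> in \<open>F0\<close> and a set
    \<open>T\<close> in \<open>Q\<close> with \<open>S A \<subseteq> T\<close>.\<close>
  have "card F0 * (card X - p) = (\<Sum>A\<in>F0. card {T \<in> Q. S A \<subseteq> T})"
  proof -
    have "card {T \<in> Q. S A \<subseteq> T} = card X - p" if "A \<in> F0" for A
    proof -
      have "{T \<in> Q. S A \<subseteq> T} = {T \<in> nsets X (p + 1). S A \<subseteq> T}"
        using that by (auto simp: Q_def)
      then show ?thesis
        using card_nsets_supersets[OF X S_sub[OF that]] S[OF that] by simp
    qed
    then show ?thesis by simp
  qed
  also have "\<dots> = (\<Sum>T\<in>Q. card {A \<in> F0. S A \<subseteq> T})"
    by (rule sum_multicount_gen) (use fin01 finQ in auto)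
  also have "\<dots> \<le> (\<Sum>T\<in>Q. p + 1)"
  proof (rule sum_mono)
    fix T assume "T \<in> Q"
    then have T: "finite T" "card T = p + 1" by (auto simp: Q_def nsets_def)
    \<comment> \<open>An own set determines its edge, so the edges counted at \<open>T\<close>
      inject into the \<open>p + 1\<close> subsets of \<open>T\<close> of size
      \<open>p\<close>.\<close>
    have "card {A \<in> F0. S A \<subseteq> T} \<le> card (nsets T p)"
    proof (rule card_inj_on_le[of S])
      show "inj_on S {A \<in> F0. S A \<subseteq> T}"
      proof (rule inj_onI)
        fix A B assume AB: "A \<in> {A \<in> F0. S A \<subseteq> T}" "B \<in> {A \<in> F0. S A \<subseteq> T}" "S A = S B"
        then have "A \<in> F0" "B \<in> F0" by blast+
        then have "own F A (S A)" "own F B (S B)" using S by blast+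
        then have "S A \<subseteq> B" "own F A (S A)" unfolding AB(3) by (simp_all add: own_def)
        moreover have "B \<in> F" using \<open>B \<in> F0\<close> by (simp add: F0_def)
        ultimately show "A = B" by (metis own_unique)
      qed
      show "S ` {A \<in> F0. S A \<subseteq> T} \<subseteq> nsets T p"
      proof (rule image_subsetI)
        fix A assume "A \<in> {A \<in> F0. S A \<subseteq> T}"
        then have "S A \<subseteq> T" "card (S A) = p" using S[of A] by simp_all
        moreover have "finite (S A)" using \<open>S A \<subseteq> T\<close> T(1) by (rule finite_subset)
        ultimately show "S A \<in> nsets T p" by (simp add: nsets_def)
      qed
      show "finite (nsets T p)" using T(1) by (simp add: finite_imp_finite_nsets)
    qed
    also have "card (nsets T p) = p + 1" using T by (simp add: card_nsets)
    finally show "card {A \<in> F0. S A \<subseteq> T} \<le> p + 1" .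
  qed
  finally have "card F0 * (card X - p) \<le> card Q * (p + 1)" by simp
  \<comment> \<open>The lower bound on \<open>card X\<close> enters here:
    \<open>D * (p + 1) \<le> card X - p\<close>, after which the factor \<open>p + 1\<close>
    cancels.\<close>
  moreover have "card F0 * (D * (p + 1)) \<le> card F0 * (card X - p)"
    using big by (intro mult_le_mono2) simp
  ultimately have "(card F0 * D) * (p + 1) \<le> card Q * (p + 1)"
    by (simp only: mult.assoc)
  then have "card F0 * D \<le> card Q"
    by (simp only: mult_le_cancel2)
  with 1 PQ show ?thesis
    by (simp add: cardF algebra_simps)
qed

section \<open>The arithmetic of \<open>t\<close> and \<open>l\<close>, and the conclusion\<close>

text \<open>With remainders taken from 1 to \<open>c\<close> instead of 0 to \<open>c - 1\<close>,
  the quotient \<open>p\<close> is always one less than the ceiling, also when \<open>c\<close>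
  divides \<open>a\<close>.\<close>

lemma ceiling_divide_decomposition:
  fixes a c l :: nat
  assumes "c \<ge> 1" "a \<ge> 1" "l \<in> {1..c}" "[l = a] (mod c)"
  obtains p where "a = c * p + l" "nat \<lceil>real a / real c\<rceil> = p + 1"
proof -
  \<comment> \<open>Otherwise \<open>l - a\<close> is a positive multiple of \<open>c\<close>, while
    \<open>a \<ge> 1\<close> and \<open>l \<le> c\<close> force \<open>l - a < c\<close>.\<close>
  have "l \<le> a"
  proof (rule ccontr)
    assume "\<not> l \<le> a"
    then have "a < l" by simp
    then have "c dvd l - a"
      using assms(4) by (metis cong_def less_imp_le mod_eq_dvd_iff_nat)
    moreover have "0 < l - a" "l - a < c" using \<open>a < l\<close> assms by auto
    ultimately show False using nat_dvd_not_less by blast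
  qed
  then have "c dvd a - l"
    using assms(4) by (metis cong_def cong_sym mod_eq_dvd_iff_nat)
  then obtain p where "a - l = c * p" by (elim dvdE)
  with \<open>l \<le> a\<close> have p: "a = c * p + l" by simp
  have "\<lceil>real a / real c\<rceil> = int p + 1"
    using assms by (subst ceiling_eq_iff) (auto simp: p field_simps)
  then show ?thesis using that[OF p] by simp
qed

theorem theorem2p2:
  fixes n k c s t l :: nat
  assumes "k \<ge> 2" and "n \<ge> k"
    and "c \<ge> 2" and "1 \<le> s" and "s \<le> c - 1"
    and "t = nat \<lceil>real (s * k) / real c\<rceil>"
    and "l \<in> {1..c}" and "[l = s * k] (mod c)"
    and "real n \<ge> (real (k choose t) - real (max_disjoint_free k t l (s + 1) (c - s + 1))) * real t
                    + real t - 1"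
  shows "real (max_frameproof c s n k) \<le>
           real (n choose t) /
             (real (k choose t) - real (max_disjoint_free k t l (s + 1) (c - s + 1)))"
proof -
  obtain p where sk: "s * k = c * p + l" and t: "t = p + 1"
    using ceiling_divide_decomposition[of c "s * k" l] assms by auto
  have l: "1 \<le> l" "l \<le> c" and s: "s \<le> c" using assms by auto
  define m where "m = max_disjoint_free k t l (s + 1) (c - s + 1)"
  define D where "D = (k choose t) - m"
  have m_less: "m < k choose t"
    using max_disjoint_free_less[OF sk l s] by (simp add: m_def t)
  then have D: "real (k choose t) - real m = real D" "D > 0"
    by (auto simp: D_def of_nat_diff)
  \<comment> \<open>With \<open>t = p + 1\<close>, the threshold for \<open>n\<close> is exactly
    \<open>D * (p + 1) + p\<close>.\<close>
  have "real (D * (p + 1) + p) \<le> real n"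
    using assms(9) unfolding m_def[symmetric] D(1) by (simp add: t algebra_simps)
  then have big: "D * (p + 1) + p \<le> card {1..n}"
    by (simp only: of_nat_le_iff card_atLeastAtMost diff_Suc_1)
  obtain F where F: "F \<subseteq> nsets {1..n} k" and fp: "frameproof c s F"
    and card: "card F = max_frameproof c s n k"
    using max_frameproof_attained by metis
  have "D * card F \<le> card {1..n} choose (p + 1)"
  proof (rule own_counting)
    fix A assume A: "A \<in> F"
    then have A': "A \<subseteq> {1..n}" "finite A" "card A = k" using F by (auto simp: nsets_def)
    then show "A \<subseteq> {1..n}" by simp
    show "(\<exists>S. card S = p \<and> own F A S) \<or> D \<le> card {T \<in> nsets A (p + 1). own F A T}"
      using card_own_ge[OF fp A A'(2,3) sk l s] by (auto simp: D_def m_def t)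
  qed (use big in auto)
  then have "real D * real (card F) \<le> real (n choose t)"
    unfolding t by (metis card_atLeastAtMost diff_Suc_1 of_nat_le_iff of_nat_mult)
  then show ?thesis
    unfolding m_def[symmetric] D(1) card[symmetric]
    using D(2) by (simp add: field_simps)
qed

end
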